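(* Let $n>k$ be positive integers, let $X$ be a real $n\times k$ matrix with $\mathrm{rank}(X)=k$, let $Z$ be a fixed real $n\times(n-k)$ matrix with $X^\top Z=0$ and $\mathrm{rank}(Z)=n-k$, let $\Omega$ be a real symmetric positive definite $n\times n$ matrix, and let $K_1,K_2$ be given real symmetric positive semidefinite $k\times k$ matrices. Consider the general linear model $y=X\beta+\varepsilon$ with $\mathrm{E}[\varepsilon]=0$ and $\mathrm{Cov}(\varepsilon)=\sigma^2\Omega$, where $\beta\in\mathbb{R}^k$ and $\sigma^2>0$. Then $$\hat{\beta}(\Omega,K_1)=\hat{\beta}(I_n,K_2)\quad\text{for every } y\in\mathbb{R}^n$$ holds if and only if both of the following hold: (a) $\Omega=X\Gamma X^\top+Z\Delta Z^\top$ for some symmetric positive definite $k\times k$ matrix $\Gamma$ and some symmetric positive definite $(n-k)\times(n-k)$ matrix $\Delta$; (b) $\mathrm{E}\big[\hat{\beta}(\Omega,K_1)\big]=\mathrm{E}\big[\hat{\beta}(I_n,K_2)\big]$ for every $\beta\in\mathbb{R}^k$.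
   Context: For a symmetric positive definite $n\times n$ matrix $\Phi$ and a symmetric positive semidefinite $k\times k$ matrix $K$, the general ridge estimator based on $y\in\mathbb{R}^n$ is $$\hat{\beta}(\Phi,K)=(X^\top\Phi^{-1}X+K)^{-1}X^\top\Phi^{-1}y .$$ $I_n$ is the $n\times n$ identity matrix. In (b) the expectation is taken under the model, where $\mathrm{E}[y]=X\beta$. *)

theory Defs
  imports "HOL-Analysis.Analysis" "HOL-Probability.Probability"
begin

definition symmetric_mat :: "real^'n^'n \<Rightarrow> bool" where
  "symmetric_mat A \<longleftrightarrow> transpose A = A"

definition sym_pos_def :: "real^'n^'n \<Rightarrow> bool" where
  "sym_pos_def A \<longleftrightarrow> symmetric_mat A \<and> (\<forall>x. x \<noteq> 0 \<longrightarrow> 0 < x \<bullet> (A *v x))"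

definition sym_pos_semidef :: "real^'n^'n \<Rightarrow> bool" where
  "sym_pos_semidef A \<longleftrightarrow> symmetric_mat A \<and> (\<forall>x. 0 \<le> x \<bullet> (A *v x))"

definition ridge :: "real^'k^'n \<Rightarrow> real^'n^'n \<Rightarrow> real^'k^'k \<Rightarrow> real^'n \<Rightarrow> real^'k" where
  "ridge X \<Phi> K y =
     (matrix_inv (transpose X ** matrix_inv \<Phi> ** X + K) ** transpose X ** matrix_inv \<Phi>) *v y"

definition cov_mat :: "'a measure \<Rightarrow> ('a \<Rightarrow> real^'n) \<Rightarrow> real^'n^'n" where
  "cov_mat M e =
     (\<chi> i j. \<integral>\<omega>. (e \<omega> $ i - (\<integral>\<omega>'. e \<omega>' $ i \<partial>M)) * (e \<omega> $ j - (\<integral>\<omega>'. e \<omega>' $ j \<partial>M)) \<partial>M)"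

text \<open>
  The errors of the model are a random vector on a probability space. Bochner integrals of
  non-integrable functions are 0 by convention, so the existence of the second moments (and,
  on a probability space, thereby of the first moments) is required explicitly.
\<close>

definition linear_model_error :: "'a measure \<Rightarrow> ('a \<Rightarrow> real^'n) \<Rightarrow> real \<Rightarrow> real^'n^'n \<Rightarrow> bool" where
  "linear_model_error M \<epsilon> \<sigma>2 \<Omega> \<longleftrightarrow>
     prob_space M \<and> \<epsilon> \<in> borel_measurable M \<and>
     (\<forall>i. integrable M (\<lambda>\<omega>. (\<epsilon> \<omega> $ i)\<^sup>2)) \<and>
     (\<integral>\<omega>. \<epsilon> \<omega> \<partial>M) = 0 \<and> cov_mat M \<epsilon> = \<sigma>2 *\<^sub>R \<Omega>"

end

theory Submission
  imports Defs
begin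

text \<open>
  Put \<open>W = X\<^sup>T \<Omega>\<^sup>-\<^sup>1\<close>, \<open>A\<^sub>1 = W X + K\<^sub>1\<close> and \<open>A\<^sub>2 = X\<^sup>T X + K\<^sub>2\<close>. The two estimators are
  the linear maps \<open>A\<^sub>1\<^sup>-\<^sup>1 W\<close> and \<open>A\<^sub>2\<^sup>-\<^sup>1 X\<^sup>T\<close>, so they agree for all data iff these matrices agree.
  Since the errors have mean zero, the expectations are obtained by multiplying the matrices
  by \<open>X\<close> on the right; condition (b) therefore says that the two maps agree on the column
  space of \<open>X\<close>.

  If the maps agree, then multiplying by \<open>\<Omega> Z\<close> on the right turns \<open>W \<Omega> Z = X\<^sup>T Z = 0\<close> into
  \<open>X\<^sup>T \<Omega> Z = 0\<close>. The column spaces of \<open>X\<close> and \<open>Z\<close> are orthogonal complements, so \<open>\<Omega>\<close> is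
  the sum of its four compressions to them, and the mixed ones vanish. The two diagonal
  ones have the form required in (a) (\<open>orthogonal_block_decomposition\<close>).

  Conversely, (a) gives \<open>X\<^sup>T \<Omega> = (X\<^sup>T X \<Gamma>) X\<^sup>T\<close>, so \<open>W = G\<^sup>-\<^sup>1 X\<^sup>T\<close> with \<open>G = X\<^sup>T X \<Gamma>\<close> invertible.
  Both maps then factor through \<open>X\<^sup>T\<close>, and because the Gram matrix \<open>X\<^sup>T X\<close> is invertible,
  agreement after multiplication by \<open>X\<close> forces the left factors, hence the maps, to agree.
\<close>

section \<open>Positive definite matrices\<close>

lemma matrix_inv_mult:
  fixes A :: "real^'n^'n"
  assumes "invertible A"
  shows "A ** matrix_inv A = mat 1" "matrix_inv A ** A = mat 1"
  using someI_ex[OF assms[unfolded invertible_def]] unfolding matrix_inv_def by auto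

lemma matrix_inv_mat_1: "matrix_inv (mat 1 :: real^'n^'n) = mat 1"
  using matrix_inv_mult(1)[of "mat 1 :: real^'n^'n"] by (simp add: invertible_def)

lemma matrix_mul_rcancel_invertible:
  fixes A :: "real^'n^'n" and B C :: "real^'n^'m"
  assumes "invertible A" and "B ** A = C ** A"
  shows "B = C"
  by (metis assms matrix_inv_mult(1) matrix_mul_assoc matrix_mul_rid)

lemma transpose_zero: "transpose (0 :: real^'m^'n) = 0"
  by (simp add: transpose_def vec_eq_iff)

lemma matrix_add_rdistrib:
  fixes A B :: "real^'n^'m" and C :: "real^'p^'n"
  shows "(A + B) ** C = A ** C + B ** C"
  by (simp add: matrix_matrix_mult_def vec_eq_iff sum.distrib distrib_right)

lemma sym_pos_def_invertible:
  assumes "sym_pos_def A"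
  shows "invertible A"
proof -
  have "A *v x = 0 \<Longrightarrow> x = 0" for x
    using assms unfolding sym_pos_def_def by (metis inner_zero_right less_irrefl)
  then show ?thesis
    by (simp add: invertible_left_inverse matrix_left_invertible_ker)
qed

lemma sym_pos_def_mat_1: "sym_pos_def (mat 1 :: real^'n^'n)"
  by (simp add: sym_pos_def_def symmetric_mat_def transpose_mat)

lemma sym_pos_def_add_semidef:
  assumes "sym_pos_def A" and "sym_pos_semidef B"
  shows "sym_pos_def (A + B)"
proof -
  have "transpose (A + B) = transpose A + transpose B"
    by (simp add: transpose_def vec_eq_iff)
  then show ?thesis
    using assms
    by (auto simp: sym_pos_def_def sym_pos_semidef_def symmetric_mat_def
        matrix_vector_mult_add_rdistrib inner_add_right add_pos_nonneg)
qed

lemma sym_pos_def_congruence: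
  fixes A :: "real^'n^'n" and C :: "real^'k^'n"
  assumes "sym_pos_def A" and "inj ((*v) C)"
  shows "sym_pos_def (transpose C ** A ** C)"
proof -
  have "transpose (transpose C ** A ** C) = transpose C ** A ** C"
    using assms(1)
    by (simp add: sym_pos_def_def symmetric_mat_def matrix_transpose_mul matrix_mul_assoc)
  moreover have "x \<bullet> ((transpose C ** A ** C) *v x) = (C *v x) \<bullet> (A *v (C *v x))" for x
  proof -
    have "(transpose C ** A ** C) *v x = transpose C *v (A *v (C *v x))"
      by (simp only: matrix_vector_mul_assoc matrix_mul_assoc)
    then show ?thesis
      by (metis dot_lmul_matrix transpose_transpose transpose_matrix_vector)
  qed
  moreover have "C *v x \<noteq> 0" if "x \<noteq> 0" for x
    using assms(2) that by (metis injD matrix_vector_mult_0_right)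
  ultimately show ?thesis
    using assms(1) by (simp add: sym_pos_def_def symmetric_mat_def)
qed

lemma sym_pos_def_gram:
  fixes C :: "real^'k^'n"
  assumes "inj ((*v) C)"
  shows "sym_pos_def (transpose C ** C)"
  using sym_pos_def_congruence[OF sym_pos_def_mat_1 assms] by simp

text \<open>
  The inverse is a congruence transform of the matrix itself: \<open>A\<^sup>-\<^sup>1 = (A\<^sup>-\<^sup>1)\<^sup>T A A\<^sup>-\<^sup>1\<close>.
\<close>

lemma sym_pos_def_matrix_inv:
  assumes "sym_pos_def A"
  shows "sym_pos_def (matrix_inv A)"
proof -
  let ?B = "matrix_inv A"
  have sym: "transpose A = A" and inv: "A ** ?B = mat 1" "?B ** A = mat 1"
    using assms matrix_inv_mult[OF sym_pos_def_invertible[OF assms]]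
    by (auto simp: sym_pos_def_def symmetric_mat_def)
  have tr: "transpose ?B ** A = mat 1"
    by (metis inv(1) sym matrix_transpose_mul transpose_mat)
  have inj: "inj ((*v) ?B)"
    using inv(1) matrix_left_invertible_injective by blast
  have "transpose ?B ** A ** ?B = ?B"
    by (simp add: tr)
  then show ?thesis
    using sym_pos_def_congruence[OF assms inj] by simp
qed

lemma inj_mult_gram_inv:
  fixes X :: "real^'k^'n"
  assumes "inj ((*v) X)"
  shows "inj ((*v) (X ** matrix_inv (transpose X ** X)))"
proof -
  let ?G = "transpose X ** X"
  have "transpose X ** (X ** matrix_inv ?G) = mat 1"
    using matrix_inv_mult(1)[OF sym_pos_def_invertible[OF sym_pos_def_gram[OF assms]]]
    by (simp add: matrix_mul_assoc)
  then show ?thesis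
    using matrix_left_invertible_injective by blast
qed

section \<open>Complementary orthogonal column spaces\<close>

definition column_proj :: "real^'k^'n \<Rightarrow> real^'n^'n" where
  "column_proj X = X ** matrix_inv (transpose X ** X) ** transpose X"

lemma transpose_matrix_inv_gram:
  fixes X :: "real^'k^'n"
  assumes "inj ((*v) X)"
  shows "transpose (matrix_inv (transpose X ** X)) = matrix_inv (transpose X ** X)"
  using sym_pos_def_matrix_inv[OF sym_pos_def_gram[OF assms]]
  by (simp add: sym_pos_def_def symmetric_mat_def)

lemma transpose_mult_column_proj:
  fixes X :: "real^'k^'n"
  assumes "inj ((*v) X)"
  shows "transpose X ** column_proj X = transpose X"
  using matrix_inv_mult(1)[OF sym_pos_def_invertible[OF sym_pos_def_gram[OF assms]]]
  by (simp add: column_proj_def matrix_mul_assoc)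

text \<open>
  Orthogonality makes the two column spaces meet only in \<open>0\<close>, so by the rank condition
  their dimensions add up to that of the whole space. A vector orthogonal to
  both of them is then orthogonal to itself.
\<close>

lemma orthogonal_columns_imp_eq_0:
  fixes X :: "real^'k^'n" and Z :: "real^'m^'n"
  assumes orth: "transpose X ** Z = 0" and rank: "rank X + rank Z = CARD('n)"
    and w: "transpose X *v w = 0" "transpose Z *v w = 0"
  shows "w = 0"
proof -
  let ?S = "range ((*v) X)" and ?T = "range ((*v) Z)"
  have XZ: "(X *v a) \<bullet> (Z *v b) = 0" for a b
  proof -
    have "(X *v a) \<bullet> (Z *v b) = a \<bullet> ((transpose X ** Z) *v b)"
      by (metis dot_lmul_matrix matrix_vector_mul_assoc transpose_matrix_vector transpose_transpose)
    then show ?thesis by (simp add: orth)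
  qed
  have sub: "subspace ?S" "subspace ?T"
    by (rule linear_subspace_image[OF matrix_vector_mul_linear subspace_UNIV])+
  have "?S \<inter> ?T \<subseteq> {0}"
  proof
    fix v assume "v \<in> ?S \<inter> ?T"
    then obtain a b where "v = X *v a" "v = Z *v b" by blast
    then have "v \<bullet> v = 0" using XZ by metis
    then show "v \<in> {0}" by simp
  qed
  then have "dim (?S \<inter> ?T) = 0"
    by (simp add: dim_eq_0)
  then have "dim {x + y |x y. x \<in> ?S \<and> y \<in> ?T} = CARD('n)"
    using dim_sums_Int[OF sub] rank unfolding rank_dim_range by linarith
  then have "span {x + y |x y. x \<in> ?S \<and> y \<in> ?T} = UNIV"
    unfolding dim_eq_full[symmetric] by simp
  then have "{x + y |x y. x \<in> ?S \<and> y \<in> ?T} = UNIV"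
    using subspace_sums[OF sub] by (simp only: span_eq_iff[THEN iffD2])
  then obtain a b where ab: "w = X *v a + Z *v b"
    by blast
  have "(X *v a) \<bullet> w = a \<bullet> (transpose X *v w)" "(Z *v b) \<bullet> w = b \<bullet> (transpose Z *v w)"
    using dot_lmul_matrix[of w X a] dot_lmul_matrix[of w Z b] by (simp_all add: inner_commute)
  moreover have "w \<bullet> w = (X *v a) \<bullet> w + (Z *v b) \<bullet> w"
    using arg_cong[OF ab, of "\<lambda>v. v \<bullet> w"] by (simp only: inner_add_left)
  ultimately have "w \<bullet> w = 0"
    using w by simp
  then show ?thesis by simp
qed

text \<open>
  The residual of a vector after both projections is orthogonal to all columns of \<open>X\<close> and \<open>Z\<close>.
\<close>

lemma column_proj_add_eq_mat_1:
  fixes X :: "real^'k^'n" and Z :: "real^'m^'n"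
  assumes X: "inj ((*v) X)" and Z: "inj ((*v) Z)"
    and orth: "transpose X ** Z = 0" and rank: "rank X + rank Z = CARD('n)"
  shows "column_proj X + column_proj Z = mat 1"
proof -
  have orth': "transpose Z ** X = 0"
    using arg_cong[OF orth, of transpose] by (simp add: matrix_transpose_mul transpose_zero)
  let ?P = "column_proj X + column_proj Z"
  have "transpose X ** ?P = transpose X"
    by (simp add: matrix_add_ldistrib transpose_mult_column_proj[OF X])
      (simp add: column_proj_def matrix_mul_assoc orth)
  moreover have "transpose Z ** ?P = transpose Z"
    by (simp add: matrix_add_ldistrib transpose_mult_column_proj[OF Z])
      (simp add: column_proj_def matrix_mul_assoc orth')
  ultimately have "v - ?P *v v = 0" for v
    by (intro orthogonal_columns_imp_eq_0[OF orth rank])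
      (simp_all only: matrix_vector_mult_diff_distrib matrix_vector_mul_assoc diff_self)
  then show ?thesis
    by (simp add: matrix_eq)
qed

text \<open>
  With \<open>C = X (X\<^sup>T X)\<^sup>-\<^sup>1\<close>, and \<open>D\<close> built likewise from \<open>Z\<close>, the resolution of the identity reads
  \<open>X C\<^sup>T + Z D\<^sup>T = 1\<close> and, transposed, \<open>C X\<^sup>T + D Z\<^sup>T = 1\<close>. Writing \<open>\<Omega> = 1 \<Omega> 1\<close> with these two forms
  yields \<open>\<Gamma> = C\<^sup>T \<Omega> C\<close> and \<open>\<Delta> = D\<^sup>T \<Omega> D\<close>, which are positive definite as congruence
  transforms of \<open>\<Omega>\<close> by injective matrices; the mixed terms are multiples of \<open>X\<^sup>T \<Omega> Z\<close> or
  of its transpose.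
\<close>

lemma orthogonal_block_decomposition:
  fixes X :: "real^'k^'n" and Z :: "real^'m^'n"
  assumes X: "inj ((*v) X)" and Z: "inj ((*v) Z)"
    and orth: "transpose X ** Z = 0" and rank: "rank X + rank Z = CARD('n)"
    and \<Omega>: "sym_pos_def \<Omega>" and mixed: "transpose X ** \<Omega> ** Z = 0"
  shows "\<exists>(\<Gamma> :: real^'k^'k) (\<Delta> :: real^'m^'m). sym_pos_def \<Gamma> \<and> sym_pos_def \<Delta> \<and>
       \<Omega> = X ** \<Gamma> ** transpose X + Z ** \<Delta> ** transpose Z"
proof -
  define C where "C = X ** matrix_inv (transpose X ** X)"
  define D where "D = Z ** matrix_inv (transpose Z ** Z)"
  have tC: "transpose C = matrix_inv (transpose X ** X) ** transpose X"
    and tD: "transpose D = matrix_inv (transpose Z ** Z) ** transpose Z"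
    by (simp_all add: C_def D_def matrix_transpose_mul transpose_matrix_inv_gram X Z)
  have P: "X ** transpose C + Z ** transpose D = mat 1"
    using column_proj_add_eq_mat_1[OF X Z orth rank]
    by (simp add: column_proj_def tC tD matrix_mul_assoc)
  have P': "C ** transpose X + D ** transpose Z = mat 1"
    using column_proj_add_eq_mat_1[OF X Z orth rank]
    by (simp add: column_proj_def C_def D_def matrix_mul_assoc)
  have CD: "transpose C ** \<Omega> ** D = 0"
  proof -
    have "transpose C ** \<Omega> ** D =
      matrix_inv (transpose X ** X) ** (transpose X ** \<Omega> ** Z) ** matrix_inv (transpose Z ** Z)"
      by (simp add: tC D_def matrix_mul_assoc)
    then show ?thesis by (simp add: mixed)
  qed
  have "transpose \<Omega> = \<Omega>"
    using \<Omega> by (simp add: sym_pos_def_def symmetric_mat_def)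
  then have DC: "transpose D ** \<Omega> ** C = 0"
    using arg_cong[OF CD, of transpose]
    by (simp add: matrix_transpose_mul transpose_zero matrix_mul_assoc)
  have "\<Omega> = (X ** transpose C + Z ** transpose D) ** \<Omega> ** (C ** transpose X + D ** transpose Z)"
    by (simp add: P P')
  also have "\<dots> = X ** (transpose C ** \<Omega> ** C) ** transpose X
      + X ** (transpose C ** \<Omega> ** D) ** transpose Z
      + (Z ** (transpose D ** \<Omega> ** C) ** transpose X
      + Z ** (transpose D ** \<Omega> ** D) ** transpose Z)"
    by (simp add: matrix_add_ldistrib matrix_add_rdistrib matrix_mul_assoc)
  finally have "\<Omega> = X ** (transpose C ** \<Omega> ** C) ** transpose X
      + Z ** (transpose D ** \<Omega> ** D) ** transpose Z"
    by (simp add: CD DC)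
  moreover have "sym_pos_def (transpose C ** \<Omega> ** C)" "sym_pos_def (transpose D ** \<Omega> ** D)"
    using sym_pos_def_congruence[OF \<Omega>] inj_mult_gram_inv[OF X] inj_mult_gram_inv[OF Z]
    by (simp_all add: C_def D_def)
  ultimately show ?thesis by blast
qed

section \<open>The error model\<close>

text \<open>
  On a probability space square integrability implies integrability, since
  \<open>\<parallel>v\<parallel> \<le> 1 + \<parallel>v\<parallel>\<^sup>2\<close>. This is what allows expectations to be exchanged with linear maps.
\<close>

lemma linear_model_error_integrable:
  assumes "linear_model_error M \<epsilon> \<sigma>2 \<Omega>"
  shows "integrable M \<epsilon>"
proof -
  interpret prob_space M
    using assms by (simp add: linear_model_error_def)
  have "integrable M (\<lambda>\<omega>. 1 + (\<Sum>i\<in>UNIV. (\<epsilon> \<omega> $ i)\<^sup>2))"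
    using assms by (simp add: linear_model_error_def)
  moreover have "norm (\<epsilon> \<omega>) \<le> norm (1 + (\<Sum>i\<in>UNIV. (\<epsilon> \<omega> $ i)\<^sup>2))" for \<omega>
  proof -
    have "(\<Sum>i\<in>UNIV. (\<epsilon> \<omega> $ i)\<^sup>2) = (norm (\<epsilon> \<omega>))\<^sup>2"
      by (simp add: norm_vec_def L2_set_def sum_nonneg)
    moreover have "norm (\<epsilon> \<omega>) \<le> 1 + (norm (\<epsilon> \<omega>))\<^sup>2"
    proof -
      have "2 * norm (\<epsilon> \<omega>) \<le> 1 + (norm (\<epsilon> \<omega>))\<^sup>2"
        using zero_le_power2[of "norm (\<epsilon> \<omega>) - 1"] by (simp add: power2_diff)
      then show ?thesis
        using norm_ge_zero[of "\<epsilon> \<omega>"] by linarith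
    qed
    ultimately show ?thesis by simp
  qed
  ultimately show ?thesis
    using assms by (intro Bochner_Integration.integrable_bound[of M
          "\<lambda>\<omega>. 1 + (\<Sum>i\<in>UNIV. (\<epsilon> \<omega> $ i)\<^sup>2)" \<epsilon>])
      (simp_all add: linear_model_error_def)
qed

lemma expectation_linear_estimator:
  fixes B :: "real^'n^'k" and X :: "real^'k^'n"
  assumes "linear_model_error M \<epsilon> \<sigma>2 \<Omega>"
  shows "(\<integral>\<omega>. B *v (X *v \<beta> + \<epsilon> \<omega>) \<partial>M) = (B ** X) *v \<beta>"
proof -
  interpret prob_space M
    using assms by (simp add: linear_model_error_def)
  have int: "integrable M \<epsilon>"
    by (rule linear_model_error_integrable[OF assms])
  have "(\<integral>\<omega>. B *v (X *v \<beta> + \<epsilon> \<omega>) \<partial>M) = B *v (\<integral>\<omega>. X *v \<beta> + \<epsilon> \<omega> \<partial>M)"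
    using int by (intro integral_bounded_linear) auto
  also have "(\<integral>\<omega>. X *v \<beta> + \<epsilon> \<omega> \<partial>M) = X *v \<beta>"
    using int assms by (simp add: linear_model_error_def prob_space)
  finally show ?thesis
    by (simp add: matrix_vector_mul_assoc)
qed

section \<open>Equality of ridge estimators\<close>

theorem theorem3p5:
  fixes X :: "real^'k^'n" and Z :: "real^'m^'n" and \<Omega> :: "real^'n^'n"
    and K1 K2 :: "real^'k^'k"
    and M :: "'a measure" and \<epsilon> :: "'a \<Rightarrow> real^'n" and \<sigma>2 :: real
  assumes "CARD('k) < CARD('n)" and "CARD('m) = CARD('n) - CARD('k)"
    and "rank X = CARD('k)"
    and "transpose X ** Z = 0" and "rank Z = CARD('n) - CARD('k)"
    and "sym_pos_def \<Omega>"
    and "sym_pos_semidef K1" and "sym_pos_semidef K2"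
    and "\<sigma>2 > 0" and "linear_model_error M \<epsilon> \<sigma>2 \<Omega>"
  shows "(\<forall>y. ridge X \<Omega> K1 y = ridge X (mat 1) K2 y) \<longleftrightarrow>
    (\<exists>(\<Gamma> :: real^'k^'k) (\<Delta> :: real^'m^'m). sym_pos_def \<Gamma> \<and> sym_pos_def \<Delta> \<and>
       \<Omega> = X ** \<Gamma> ** transpose X + Z ** \<Delta> ** transpose Z) \<and>
    (\<forall>\<beta>. (\<integral>\<omega>. ridge X \<Omega> K1 (X *v \<beta> + \<epsilon> \<omega>) \<partial>M) = (\<integral>\<omega>. ridge X (mat 1) K2 (X *v \<beta> + \<epsilon> \<omega>) \<partial>M))"
    (is "?eq \<longleftrightarrow> ?a \<and> ?b")
proof -
  define W where "W = transpose X ** matrix_inv \<Omega>"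
  define A1 where "A1 = W ** X + K1"
  define A2 where "A2 = transpose X ** X + K2"
  have X: "inj ((*v) X)" and Z: "inj ((*v) Z)"
    using assms(2,3,5) by (simp_all add: full_rank_injective[symmetric])
  have rank: "rank X + rank Z = CARD('n)"
    using assms(1,3,5) by simp
  have A2: "invertible A2"
    unfolding A2_def
    by (intro sym_pos_def_invertible sym_pos_def_add_semidef sym_pos_def_gram X assms(8))
  have gram: "invertible (transpose X ** X)"
    by (intro sym_pos_def_invertible sym_pos_def_gram X)
  note iA2 = matrix_inv_mult[OF A2]
  note i\<Omega> = matrix_inv_mult[OF sym_pos_def_invertible[OF assms(6)]]
  have W\<Omega>: "W ** \<Omega> = transpose X"
    by (simp add: W_def matrix_mul_assoc[symmetric] i\<Omega>)
  have r1: "ridge X \<Omega> K1 y = (matrix_inv A1 ** W) *v y" for y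
    by (simp add: ridge_def A1_def W_def matrix_mul_assoc)
  have r2: "ridge X (mat 1) K2 y = (matrix_inv A2 ** transpose X) *v y" for y
    by (simp add: ridge_def A2_def matrix_inv_mat_1)
  have eq: "?eq \<longleftrightarrow> matrix_inv A1 ** W = matrix_inv A2 ** transpose X"
    by (simp only: r1 r2 matrix_eq)
  have b: "?b \<longleftrightarrow> matrix_inv A1 ** W ** X = matrix_inv A2 ** transpose X ** X"
    by (simp only: r1 r2 expectation_linear_estimator[OF assms(10)] matrix_eq)
  show ?thesis
  proof
    assume ?eq
    then have E: "matrix_inv A1 ** W = matrix_inv A2 ** transpose X"
      using eq by blast
    have "matrix_inv A2 ** (transpose X ** \<Omega> ** Z) = matrix_inv A1 ** (W ** \<Omega>) ** Z"
      by (simp add: E matrix_mul_assoc)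
    also have "\<dots> = matrix_inv A1 ** (transpose X ** Z)"
      by (simp add: W\<Omega> matrix_mul_assoc)
    finally have "matrix_inv A2 ** (transpose X ** \<Omega> ** Z) = 0"
      by (simp add: assms(4))
    then have "A2 ** matrix_inv A2 ** (transpose X ** \<Omega> ** Z) = 0"
      by (metis matrix_mul_assoc times0_right)
    then have "transpose X ** \<Omega> ** Z = 0"
      by (simp add: iA2)
    then have ?a
      by (rule orthogonal_block_decomposition[OF X Z assms(4) rank assms(6)])
    moreover have ?b
      using b by (simp add: E)
    ultimately show "?a \<and> ?b" ..
  next
    assume "?a \<and> ?b"
    then obtain \<Gamma> :: "real^'k^'k" and \<Delta> :: "real^'m^'m" where \<Gamma>: "sym_pos_def \<Gamma>"
      and \<Omega>: "\<Omega> = X ** \<Gamma> ** transpose X + Z ** \<Delta> ** transpose Z"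
      and E: "matrix_inv A1 ** W ** X = matrix_inv A2 ** transpose X ** X"
      using b by blast
    define G where "G = transpose X ** X ** \<Gamma>"
    have G: "invertible G"
      unfolding G_def by (intro invertible_mult gram sym_pos_def_invertible \<Gamma>)
    have "transpose X ** \<Omega> = G ** transpose X"
      by (subst \<Omega>) (simp add: G_def matrix_add_ldistrib matrix_mul_assoc assms(4))
    then have GW: "G ** W = transpose X"
      by (metis W_def i\<Omega>(1) matrix_mul_assoc matrix_mul_rid)
    then have W: "W = matrix_inv G ** transpose X"
      by (metis matrix_inv_mult(2)[OF G] matrix_mul_assoc matrix_mul_lid)
    have "matrix_inv A1 ** matrix_inv G ** (transpose X ** X) = matrix_inv A2 ** (transpose X ** X)"
      using E by (simp add: W matrix_mul_assoc)
    then have "matrix_inv A1 ** matrix_inv G = matrix_inv A2"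
      by (rule matrix_mul_rcancel_invertible[OF gram])
    then show ?eq
      by (simp add: eq W matrix_mul_assoc)
  qed
qed

end
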